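(* Let $\mathcal{X}$ be a Borel subset of $\mathbb{R}^{\mathbb{N}}$ or $\mathbb{C}^{\mathbb{N}}$. For a set $\mathcal{Y}$ of sequences and $k\ge 1$ let $\operatorname{Proj}_k(\mathcal{Y}):=\{(x_1,\ldots,x_k): x\in\mathcal{Y}\}$. (i) If $\mathcal{X}\cap\ell^2=\emptyset$ and $$\liminf_{k\to\infty}\frac{\log|\operatorname{Proj}_k(\mathcal{X})|}{\inf_{y\in\mathcal{X}}\sum_{n=1}^k|y_n|^2}<\frac18,$$ then $\mathcal{X}$ admits detection. (ii) Let $\{k_j\}$ be an increasing sequence of positive integers tending to infinity. For $x\in\mathcal{X}$ and $i\ge1$ let $\mathcal{X}_i^x:=\{y\in\mathcal{X}: (y_1,\ldots,y_i)\ne(x_1,\ldots,x_i)\}$. Suppose that for every $x\in\mathcal{X}$ and every $i\ge 1$, $$\sum_j |\operatorname{Proj}_{k_j}(\mathcal{X}_i^x)|\exp\Big(-\frac18\inf_{y\in\mathcal{X}_i^x}\sum_{n=1}^{k_j}|y_n-x_n|^2\Big)<\infty.$$ Then $\mathcal{X}$ admits recovery.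
   Context: Noise: $\xi=(\xi_n)_{n\in\mathbb{N}}$ is a sequence of independent standard Gaussian random variables: in the real case $\xi_n\sim N(0,1)$; in the complex case the real and imaginary parts of $\xi_n$ are independent and each distributed as $N(0,1)$. Let $\mathbb{K}=\mathbb{R}$ or $\mathbb{C}$ accordingly. A set $\mathcal{X}\subset\mathbb{K}^{\mathbb{N}}$ admits recovery if there is a Borel measurable map $T:\mathbb{K}^{\mathbb{N}}\to\mathbb{K}^{\mathbb{N}}$ such that for each $x\in\mathcal{X}$, $T(x+\xi)=x$ almost surely. It admits detection if there is a Borel measurable map $T:\mathbb{K}^{\mathbb{N}}\to\{0,1\}$ such that $T(\xi)=0$ almost surely and, for every $x\in\mathcal{X}$, $T(x+\xi)=1$ almost surely. (Borel structure is that of the product topology.) $|\cdot|$ of a set is its cardinality, equal to $+\infty$ for an infinite set (in which case the corresponding quotient or summand is $+\infty$). A quotient with zero denominator is read as $+\infty$, and a summand with $\mathcal{X}_i^x=\emptyset$ is read as $0$. *)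

theory Defs
  imports "HOL-Probability.Probability"
begin

(* Sequences (x_1, x_2, ...) are functions on nat, with x_n stored at index n - 1.  On
   nat => 'a the library topology is the product topology, so borel is its Borel structure. *)

definition real_gaussian_noise :: "'w measure \<Rightarrow> (nat \<Rightarrow> 'w \<Rightarrow> real) \<Rightarrow> bool" where
  "real_gaussian_noise M \<xi> \<longleftrightarrow>
     prob_space M \<and>
     prob_space.indep_vars M (\<lambda>_. borel) \<xi> UNIV \<and>
     (\<forall>n. distributed M lborel (\<xi> n) std_normal_density)"

definition complex_gaussian_noise :: "'w measure \<Rightarrow> (nat \<Rightarrow> 'w \<Rightarrow> complex) \<Rightarrow> bool" where
  "complex_gaussian_noise M \<xi> \<longleftrightarrow>
     prob_space M \<and>
     prob_space.indep_vars M (\<lambda>_. borel) \<xi> UNIV \<and>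
     (\<forall>n. prob_space.indep_var M borel (\<lambda>\<omega>. Re (\<xi> n \<omega>)) borel (\<lambda>\<omega>. Im (\<xi> n \<omega>)) \<and>
          distributed M lborel (\<lambda>\<omega>. Re (\<xi> n \<omega>)) std_normal_density \<and>
          distributed M lborel (\<lambda>\<omega>. Im (\<xi> n \<omega>)) std_normal_density)"

definition admits_recovery ::
  "'w measure \<Rightarrow> (nat \<Rightarrow> 'w \<Rightarrow> 'a::real_normed_vector) \<Rightarrow> (nat \<Rightarrow> 'a) set \<Rightarrow> bool" where
  "admits_recovery M \<xi> X \<longleftrightarrow>
     (\<exists>T :: (nat \<Rightarrow> 'a) \<Rightarrow> (nat \<Rightarrow> 'a).
        T \<in> borel \<rightarrow>\<^sub>M borel \<and>
        (\<forall>x\<in>X. AE \<omega> in M. T (\<lambda>n. x n + \<xi> n \<omega>) = x))"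

definition admits_detection ::
  "'w measure \<Rightarrow> (nat \<Rightarrow> 'w \<Rightarrow> 'a::real_normed_vector) \<Rightarrow> (nat \<Rightarrow> 'a) set \<Rightarrow> bool" where
  "admits_detection M \<xi> X \<longleftrightarrow>
     (\<exists>T :: (nat \<Rightarrow> 'a) \<Rightarrow> nat.
        T \<in> borel \<rightarrow>\<^sub>M count_space {0, 1} \<and>
        (AE \<omega> in M. T (\<lambda>n. \<xi> n \<omega>) = 0) \<and>
        (\<forall>x\<in>X. AE \<omega> in M. T (\<lambda>n. x n + \<xi> n \<omega>) = 1))"

definition ell2 :: "(nat \<Rightarrow> 'a::real_normed_vector) set" where
  "ell2 = {x. summable (\<lambda>n. (norm (x n))\<^sup>2)}"

definition Proj :: "nat \<Rightarrow> (nat \<Rightarrow> 'a) set \<Rightarrow> (nat \<Rightarrow> 'a) set" where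
  "Proj k Y = (\<lambda>x. restrict x {..<k}) ` Y"

definition prefix_differs :: "(nat \<Rightarrow> 'a) set \<Rightarrow> nat \<Rightarrow> (nat \<Rightarrow> 'a) \<Rightarrow> (nat \<Rightarrow> 'a) set" where
  "prefix_differs X i x = {y \<in> X. \<exists>n<i. y n \<noteq> x n}"

definition log_card :: "'b set \<Rightarrow> ereal" where
  "log_card A =
     (if infinite A then \<infinity> else if A = {} then -\<infinity> else ereal (ln (real (card A))))"

(* In ereal, 0 / 0 = 0; here a zero denominator has to give infinity in all cases. *)
definition ext_quotient :: "ereal \<Rightarrow> ereal \<Rightarrow> ereal" where
  "ext_quotient a b = (if b = 0 then \<infinity> else a / b)"

definition detection_quotient :: "(nat \<Rightarrow> 'a::real_normed_vector) set \<Rightarrow> nat \<Rightarrow> ereal" where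
  "detection_quotient X k =
     ext_quotient (log_card (Proj k X)) (INF y\<in>X. ereal (\<Sum>n<k. (norm (y n))\<^sup>2))"

(* emeasure (count_space UNIV) is the cardinality with value infinity on infinite sets.
   For nonempty Y the infimum is that of a nonempty set of nonnegative reals. *)
definition recovery_summand ::
  "(nat \<Rightarrow> 'a::real_normed_vector) set \<Rightarrow> (nat \<Rightarrow> 'a) \<Rightarrow> nat \<Rightarrow> ennreal" where
  "recovery_summand Y x k =
     (if Y = {} then 0
      else emeasure (count_space UNIV) (Proj k Y) *
           ennreal (exp (- (1 / 8) * (INF y\<in>Y. \<Sum>n<k. (norm (y n - x n))\<^sup>2))))"

end

(* With u = v - x, the noise makes the candidate v look at least as good as the truth x exactly when
   |xi - u|^2 <= |xi|^2, and by the Chernoff bound with parameter 1/2 this has probability at most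
   exp (- |u|^2 / 8).  A union bound over the finite set of prefixes of length k gives error terms as
   in the two hypotheses.  For recovery, take the nearest prefix of length k_j; by Borel-Cantelli each
   of its coordinates is eventually correct.  For detection, test whether some prefix of X is at least
   as close to the observation as 0.  Here the infimum of the energies must be unbounded along the
   good k: otherwise the prefix sets have bounded size, X is finite, and a finite set avoiding ell^2
   has unbounded energy after all.  So some k_j make the error probabilities summable. *)

theory Submission
  imports Defs
begin

section \<open>Moment generating functions of real and complex Gaussian noise\<close>

abbreviation energy :: "nat \<Rightarrow> (nat \<Rightarrow> 'a::real_normed_vector) \<Rightarrow> real" where
  "energy k y \<equiv> \<Sum>n<k. (norm (y n))\<^sup>2"

text \<open>Stated by the moment generating function so that the real and the complex noise, whose real
  and imaginary parts each have variance 1, are both instances.\<close>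

locale gaussian_noise = prob_space M
  for M :: "'w measure" and \<xi> :: "nat \<Rightarrow> 'w \<Rightarrow> 'a::euclidean_space" +
  assumes indep: "indep_vars (\<lambda>_. borel) \<xi> UNIV"
    and mgf: "\<And>n u. (\<integral>\<^sup>+\<omega>. ennreal (exp (u \<bullet> \<xi> n \<omega>)) \<partial>M) = ennreal (exp ((norm u)\<^sup>2 / 2))"

text \<open>Completing the square turns the tilted density into a constant times the normal density
  with mean \<open>t\<close>, whose total mass is 1.\<close>

lemma std_normal_mgf:
  assumes "distributed M lborel X std_normal_density"
  shows "(\<integral>\<^sup>+\<omega>. ennreal (exp (t * X \<omega>)) \<partial>M) = ennreal (exp (t\<^sup>2 / 2))"
proof -
  have shift: "std_normal_density x * exp (t * x) = exp (t\<^sup>2 / 2) * normal_density t 1 x" for x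
    by (simp add: normal_density_def exp_add [symmetric] field_simps power2_eq_square)
  have "(\<integral>\<^sup>+\<omega>. ennreal (exp (t * X \<omega>)) \<partial>M)
      = (\<integral>\<^sup>+x. ennreal (std_normal_density x) * ennreal (exp (t * x)) \<partial>lborel)"
    using assms by (intro distributed_nn_integral [symmetric]) auto
  also have "\<dots> = (\<integral>\<^sup>+x. ennreal (exp (t\<^sup>2 / 2)) * ennreal (normal_density t 1 x) \<partial>lborel)"
    by (simp add: shift ennreal_mult [symmetric])
  also have "\<dots> = ennreal (exp (t\<^sup>2 / 2)) * (\<integral>\<^sup>+x. ennreal (normal_density t 1 x) \<partial>lborel)"
    by (intro nn_integral_cmult) auto
  also have "(\<integral>\<^sup>+x. ennreal (normal_density t 1 x) \<partial>lborel) = 1"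
    by (subst nn_integral_eq_integral) auto
  finally show ?thesis by simp
qed

lemma gaussian_noise_real:
  assumes "real_gaussian_noise M \<xi>"
  shows "gaussian_noise M \<xi>"
proof -
  interpret prob_space M
    using assms by (simp add: real_gaussian_noise_def)
  show ?thesis
    using assms
    by unfold_locales (auto simp: real_gaussian_noise_def std_normal_mgf)
qed

text \<open>The real inner product on the complex plane splits into a real and an imaginary term. By
  independence the expectation factors, and the two exponents add up to half the squared modulus of
  \<open>u\<close>.\<close>

lemma gaussian_noise_complex:
  assumes "complex_gaussian_noise M \<xi>"
  shows "gaussian_noise M \<xi>"
proof -
  interpret prob_space M
    using assms by (simp add: complex_gaussian_noise_def)
  show ?thesis
  proof
    show "indep_vars (\<lambda>_. borel) \<xi> UNIV"
      using assms by (simp add: complex_gaussian_noise_def)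
  next
    fix n and u :: complex
    let ?X = "\<lambda>\<omega>. ennreal (exp (Re u * Re (\<xi> n \<omega>)))"
    let ?Y = "\<lambda>\<omega>. ennreal (exp (Im u * Im (\<xi> n \<omega>)))"
    have indep: "indep_var borel (\<lambda>\<omega>. Re (\<xi> n \<omega>)) borel (\<lambda>\<omega>. Im (\<xi> n \<omega>))"
      and Re: "distributed M lborel (\<lambda>\<omega>. Re (\<xi> n \<omega>)) std_normal_density"
      and Im: "distributed M lborel (\<lambda>\<omega>. Im (\<xi> n \<omega>)) std_normal_density"
      using assms by (auto simp: complex_gaussian_noise_def)
    have "indep_var borel ((\<lambda>x. ennreal (exp (Re u * x))) \<circ> (\<lambda>\<omega>. Re (\<xi> n \<omega>)))
                    borel ((\<lambda>x. ennreal (exp (Im u * x))) \<circ> (\<lambda>\<omega>. Im (\<xi> n \<omega>)))"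
      by (rule indep_var_compose [OF indep]) auto
    then have "indep_vars (\<lambda>_. borel) (case_bool ?X ?Y) UNIV"
      unfolding indep_var_def comp_def
      by (elim indep_vars_cong [THEN iffD1, rotated -1]) (auto split: bool.split)
    then have "(\<integral>\<^sup>+\<omega>. (\<Prod>i\<in>UNIV. case_bool ?X ?Y i \<omega>) \<partial>M)
        = (\<Prod>i\<in>UNIV. \<integral>\<^sup>+\<omega>. case_bool ?X ?Y i \<omega> \<partial>M)"
      by (intro indep_vars_nn_integral) (auto split: bool.split)
    then have "(\<integral>\<^sup>+\<omega>. ?X \<omega> * ?Y \<omega> \<partial>M) = (\<integral>\<^sup>+\<omega>. ?X \<omega> \<partial>M) * (\<integral>\<^sup>+\<omega>. ?Y \<omega> \<partial>M)"
      by (simp add: UNIV_bool mult.commute)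
    then show "(\<integral>\<^sup>+\<omega>. ennreal (exp (u \<bullet> \<xi> n \<omega>)) \<partial>M) = ennreal (exp ((norm u)\<^sup>2 / 2))"
      by (simp add: std_normal_mgf [OF Re] std_normal_mgf [OF Im] inner_complex_def exp_add
          ennreal_mult cmod_power2 add_divide_distrib)
  qed
qed

section \<open>Chernoff and union bounds for nearest-point errors\<close>

context gaussian_noise
begin

lemma measurable_noise [measurable]: "\<xi> n \<in> borel_measurable M"
  using indep by (auto simp: indep_vars_def)

text \<open>The event that a nearest-point rule may prefer a candidate at displacement \<open>u\<close> to the truth.\<close>

definition confusion :: "nat \<Rightarrow> (nat \<Rightarrow> 'a) \<Rightarrow> 'w set" where
  "confusion k u = {\<omega> \<in> space M. energy k (\<lambda>n. \<xi> n \<omega> - u n) \<le> energy k (\<lambda>n. \<xi> n \<omega>)}"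

lemma confusion_measurable [measurable]: "confusion k u \<in> events"
  unfolding confusion_def by measurable

lemma prob_confusion_le: "prob (confusion k u) \<le> exp (- energy k u / 8)"
proof -
  let ?E = "energy k u" and ?S = "\<lambda>\<omega>. \<Sum>n<k. u n \<bullet> \<xi> n \<omega>"
  \<comment> \<open>Expanding the square cancels the energy of the noise and leaves a half-space
    condition on the linear form \<open>?S\<close>.\<close>
  have "energy k (\<lambda>n. \<xi> n \<omega> - u n) = energy k (\<lambda>n. \<xi> n \<omega>) - 2 * ?S \<omega> + ?E" for \<omega>
    by (simp add: power2_norm_eq_inner inner_diff inner_commute sum.distrib sum_subtractf
        sum_distrib_left algebra_simps)
  then have confusion: "confusion k u = {\<omega> \<in> space M. ?S \<omega> \<ge> ?E / 2}"
    by (auto simp: confusion_def)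
  \<comment> \<open>With parameter \<open>s\<close> the Chernoff exponent is
    \<open>- s * ?E / 2 + s^2 * ?E / 2\<close>, which is smallest at \<open>s = 1/2\<close>.\<close>
  have "indep_vars (\<lambda>_. borel) (\<lambda>n \<omega>. ennreal (exp (((1/2) *\<^sub>R u n) \<bullet> \<xi> n \<omega>))) {..<k}"
    by (intro indep_vars_compose2 [OF indep_vars_subset [OF indep]]) auto
  then have "(\<integral>\<^sup>+\<omega>. (\<Prod>n<k. ennreal (exp (((1/2) *\<^sub>R u n) \<bullet> \<xi> n \<omega>))) \<partial>M)
      = (\<Prod>n<k. ennreal (exp ((norm ((1/2) *\<^sub>R u n))\<^sup>2 / 2)))"
    by (subst indep_vars_nn_integral) (auto simp: mgf simp del: inner_scaleR_left)
  also have "\<dots> = ennreal (exp (?E / 8))"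
    by (simp add: prod_ennreal exp_sum [symmetric] sum_divide_distrib power_mult_distrib
        power_divide)
  also have "(\<lambda>\<omega>. \<Prod>n<k. ennreal (exp (((1/2) *\<^sub>R u n) \<bullet> \<xi> n \<omega>)))
      = (\<lambda>\<omega>. ennreal (exp (1/2 * ?S \<omega>)))"
    by (simp add: prod_ennreal exp_sum [symmetric] sum_divide_distrib)
  finally have mgf_sum: "(\<integral>\<^sup>+\<omega>. ennreal (exp (1/2 * ?S \<omega>)) \<partial>M) = ennreal (exp (?E / 8))" .
  have "emeasure M (confusion k u)
      \<le> ennreal (exp (- (1/2) * (?E / 2))) * (\<integral>\<^sup>+\<omega>\<in>space M. ennreal (exp (1/2 * ?S \<omega>)) \<partial>M)"
    unfolding confusion by (intro Chernoff_ineq_nn_integral_ge) auto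
  also have "(\<integral>\<^sup>+\<omega>\<in>space M. ennreal (exp (1/2 * ?S \<omega>)) \<partial>M) = ennreal (exp (?E / 8))"
    by (subst mgf_sum [symmetric], rule nn_integral_cong) auto
  also have "ennreal (exp (- (1/2) * (?E / 2))) * ennreal (exp (?E / 8)) = ennreal (exp (- ?E / 8))"
    by (simp add: ennreal_mult [symmetric] exp_add [symmetric])
  finally show ?thesis
    by (simp add: emeasure_eq_measure)
qed

lemma prob_Union_confusion_le:
  assumes "finite V" and "\<And>v. v \<in> V \<Longrightarrow> b \<le> energy k (\<lambda>n. v n - x n)"
  shows "prob (\<Union>v\<in>V. confusion k (\<lambda>n. v n - x n)) \<le> real (card V) * exp (- (1 / 8) * b)"
proof -
  have "prob (\<Union>v\<in>V. confusion k (\<lambda>n. v n - x n)) \<le> (\<Sum>v\<in>V. prob (confusion k (\<lambda>n. v n - x n)))"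
    using assms(1) by (intro finite_measure_subadditive_finite) auto
  also have "\<dots> \<le> (\<Sum>v\<in>V. exp (- (1 / 8) * b))"
    using assms(2) by (intro sum_mono order_trans [OF prob_confusion_le]) auto
  finally show ?thesis by simp
qed

text \<open>Prefixes are \<open>undefined\<close> from index \<open>k\<close> on, but
  \<open>energy k\<close> reads only indices below \<open>k\<close>, so a bound on \<open>Y\<close>
  carries over to its prefixes.\<close>

lemma prob_Union_confusion_Proj_le:
  assumes "finite (Proj k Y)" and "\<And>y. y \<in> Y \<Longrightarrow> b \<le> energy k (\<lambda>n. y n - x n)"
  shows "prob (\<Union>v\<in>Proj k Y. confusion k (\<lambda>n. v n - x n))
    \<le> real (card (Proj k Y)) * exp (- (1 / 8) * b)"
  using assms by (intro prob_Union_confusion_le) (auto simp: Proj_def)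

end

section \<open>Measurable comparisons, sizes of prefix sets and growth of energies\<close>

lemma pred_energy_diff_le:
  fixes u v :: "nat \<Rightarrow> 'a::euclidean_space"
  shows "Measurable.pred borel (\<lambda>y. energy k (\<lambda>n. y n - v n) \<le> energy k (\<lambda>n. y n - u n))"
proof -
  have [measurable]: "(\<lambda>y. y n - w n) \<in> borel_measurable borel" for n and w :: "nat \<Rightarrow> 'a"
    by (rule borel_measurable_diff) (rule measurable_product_coordinates, simp)
  have "(\<lambda>y. energy k (\<lambda>n. y n - w n)) \<in> borel_measurable borel" for w :: "nat \<Rightarrow> 'a"
    by measurable
  from borel_measurable_le [OF this this] show ?thesis
    by (simp add: pred_def)
qed

lemma eventually_restrict_neq:
  assumes "x \<noteq> y"
  shows "eventually (\<lambda>k. restrict x {..<k} \<noteq> restrict y {..<k}) sequentially"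
proof -
  obtain n where n: "x n \<noteq> y n"
    using assms by blast
  have "restrict x {..<k} \<noteq> restrict y {..<k}" if "k > n" for k
    using n that by (metis lessThan_iff restrict_apply')
  then show ?thesis
    using eventually_gt_at_top [of n] by (rule eventually_mono [rotated])
qed

text \<open>Any \<open>B + 1\<close> distinct sequences have distinct prefixes at all sufficiently
  large lengths, and the bound \<open>B\<close> holds at one of these.\<close>

lemma finite_if_frequently_card_Proj_le:
  assumes "frequently (\<lambda>k. finite (Proj k X) \<and> card (Proj k X) \<le> B) sequentially"
  shows "finite X"
proof (rule ccontr)
  assume "infinite X"
  then obtain F where F: "finite F" "card F = Suc B" "F \<subseteq> X"
    using infinite_arbitrarily_large by blast
  have "eventually (\<lambda>k. \<forall>x\<in>F. \<forall>y\<in>F. x \<noteq> y \<longrightarrow> restrict x {..<k} \<noteq> restrict y {..<k}) sequentially"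
    using F(1) by (intro eventually_ball_finite ballI) (auto intro: eventually_restrict_neq)
  from frequently_ex [OF frequently_eventually_conj [OF assms this]]
  obtain k where k: "finite (Proj k X)" "card (Proj k X) \<le> B"
      "inj_on (\<lambda>x. restrict x {..<k}) F"
    unfolding inj_on_def by blast
  have "card F = card (Proj k F)"
    using k(3) by (simp add: Proj_def card_image)
  also have "\<dots> \<le> card (Proj k X)"
    using F(3) by (intro card_mono k(1)) (auto simp: Proj_def)
  finally show False
    using F(2) k(2) by simp
qed

lemma eventually_energy_ge:
  assumes "y \<notin> ell2"
  shows "eventually (\<lambda>k. L \<le> energy k y) sequentially"
proof -
  obtain k where "L < energy k y"
  proof (rule ccontr)
    assume "\<not> thesis"
    then have "energy n y \<le> L" for n
      using that by (meson not_le)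
    then have "summable (\<lambda>n. (norm (y n))\<^sup>2)"
      by (intro summableI_nonneg_bounded) auto
    with assms show False
      by (simp add: ell2_def)
  qed
  then have "L \<le> energy j y" if "j \<ge> k" for j
    using sum_mono2 [of "{..<j}" "{..<k}" "\<lambda>n. (norm (y n))\<^sup>2"] that by auto
  then show ?thesis
    by (auto simp: eventually_sequentially)
qed

lemma bdd_below_energy: "bdd_below ((\<lambda>y. energy k (f y)) ` Y)"
  by (rule bdd_belowI2 [of _ 0]) (simp add: sum_nonneg)

text \<open>The quotient controls the number of prefixes only relative to the least energy; the
  further bound by an arbitrary \<open>L\<close> later makes the error probabilities small.\<close>

lemma frequently_detection_quotient_less:
  assumes ne: "X \<noteq> {}" and disj: "X \<inter> ell2 = {}"
    and freq: "frequently (\<lambda>k. detection_quotient X k < ereal c) sequentially"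
  shows "frequently (\<lambda>k. finite (Proj k X) \<and>
      ln (real (card (Proj k X))) \<le> c * (INF y\<in>X. energy k y) \<and>
      L \<le> (INF y\<in>X. energy k y)) sequentially"
proof -
  define m where "m k = (INF y\<in>X. energy k y)" for k
  have m_nonneg: "0 \<le> m k" for k
    unfolding m_def by (intro cINF_greatest ne) (simp add: sum_nonneg)
  define P where "P k \<longleftrightarrow> finite (Proj k X) \<and> ln (real (card (Proj k X))) \<le> c * m k" for k
  have "P k" if "detection_quotient X k < ereal c" for k
  proof -
    have INF: "(INF y\<in>X. ereal (energy k y)) = ereal (m k)"
      using ereal_Inf' [OF bdd_below_energy [where k = k and f = "\<lambda>y. y" and Y = X]] ne
      by (simp add: m_def image_image)
    \<comment> \<open>A zero denominator makes the quotient infinite, and so does an infinite prefix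
      set in the next step; neither can occur below \<open>c\<close>.\<close>
    have pos: "m k > 0"
      using that m_nonneg [of k]
      by (auto simp: detection_quotient_def ext_quotient_def INF zero_ereal_def split: if_splits)
    have fin: "finite (Proj k X)"
      using that pos
      by (auto simp: detection_quotient_def ext_quotient_def INF log_card_def split: if_splits)
    have "Proj k X \<noteq> {}"
      using ne by (simp add: Proj_def)
    then have "ln (real (card (Proj k X))) / m k < c"
      using that pos fin
      by (auto simp: detection_quotient_def ext_quotient_def INF log_card_def)
    then show ?thesis
      using pos fin by (simp add: P_def field_simps)
  qed
  with freq have freq_P: "frequently P sequentially"
    by (auto elim: frequently_elim1)
  show ?thesis
  proof (rule ccontr)
    assume "\<not> ?thesis"
    then have small: "eventually (\<lambda>k. P k \<longrightarrow> m k < L) sequentially"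
      by (auto simp: not_frequently P_def m_def not_le elim!: eventually_mono)
    \<comment> \<open>The absolute value covers a negative \<open>c\<close>. The bound does not
      depend on \<open>k\<close>, as the finiteness criterion for \<open>X\<close> requires.\<close>
    have "finite (Proj k X) \<and> card (Proj k X) \<le> nat \<lceil>exp (\<bar>c\<bar> * L)\<rceil>"
      if "P k" "P k \<longrightarrow> m k < L" for k
    proof -
      have "Proj k X \<noteq> {}"
        using ne by (simp add: Proj_def)
      then have "card (Proj k X) > 0"
        using that by (auto simp: P_def card_gt_0_iff)
      moreover have "c * m k \<le> \<bar>c\<bar> * L"
        using that m_nonneg [of k] by (intro mult_mono) auto
      then have "ln (real (card (Proj k X))) \<le> \<bar>c\<bar> * L"
        using that by (simp add: P_def)
      ultimately have "real (card (Proj k X)) \<le> exp (\<bar>c\<bar> * L)"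
        by (metis exp_le_cancel_iff exp_ln of_nat_0_less_iff)
      then show ?thesis
        using that by (auto simp: P_def) linarith
    qed
    then have "finite X"
      using frequently_eventually_conj [OF freq_P small]
      by (intro finite_if_frequently_card_Proj_le [where B = "nat \<lceil>exp (\<bar>c\<bar> * L)\<rceil>"])
         (auto elim: frequently_elim1)
    \<comment> \<open>Each of the finitely many sequences lies outside \<open>ell2\<close>, so from
      a common length on all have energy at least \<open>L\<close>, which contradicts
      \<open>small\<close>.\<close>
    then have "eventually (\<lambda>k. \<forall>y\<in>X. L \<le> energy k y) sequentially"
      using disj by (intro eventually_ball_finite ballI eventually_energy_ge) auto
    then have "eventually (\<lambda>k. L \<le> m k) sequentially"
      unfolding m_def by (rule eventually_mono) (auto intro!: cINF_greatest ne)
    with small have "eventually (\<lambda>k. \<not> P k) sequentially"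
      by eventually_elim auto
    with freq_P show False
      by (simp add: frequently_def)
  qed
qed

lemma finite_Proj_if_summand_finite:
  assumes "y \<in> Y" "recovery_summand Y x k < \<infinity>"
  shows "finite (Proj k Y)"
proof (rule ccontr)
  assume "infinite (Proj k Y)"
  then have "recovery_summand Y x k = \<infinity>"
    using assms(1) by (auto simp: recovery_summand_def ennreal_top_mult)
  with assms(2) show False by simp
qed

text \<open>Borel-Cantelli in the form needed for error events, whose probabilities are known only
  through a summable majorant.\<close>

lemma (in prob_space) AE_eventually_not_in:
  assumes "\<And>j. A j \<in> events" "\<And>j. prob (A j) \<le> p j" "summable p"
  shows "AE \<omega> in M. eventually (\<lambda>j. \<omega> \<notin> A j) sequentially"
proof -
  have "summable (\<lambda>j. prob (A j))"
    by (rule summable_comparison_test' [OF assms(3), of 0]) (simp add: assms(2))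
  then have "AE \<omega> in M. eventually (\<lambda>j. \<omega> \<in> space M - A j) sequentially"
    by (intro borel_cantelli_AE1 assms(1)) (simp_all add: emeasure_eq_measure)
  then show ?thesis
  proof (rule AE_mp, intro AE_I2 impI)
    show "eventually (\<lambda>j. \<omega> \<notin> A j) sequentially"
      if "eventually (\<lambda>j. \<omega> \<in> space M - A j) sequentially" for \<omega>
      using that by (rule eventually_mono) simp
  qed
qed

section \<open>Detection by comparing prefixes with the zero sequence\<close>

context gaussian_noise
begin

theorem detection:
  fixes X :: "(nat \<Rightarrow> 'a) set"
  assumes disj: "X \<inter> ell2 = {}" and liminf: "liminf (detection_quotient X) < ereal (1 / 8)"
  shows "admits_detection M \<xi> X"
proof (cases "X = {}")
  case True
  then show ?thesis
    unfolding admits_detection_def by (intro exI [of _ "\<lambda>_. 0"]) auto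
next
  case ne: False
  \<comment> \<open>The gap between \<open>c\<close> and \<open>1 / 8\<close> lets the exponential
    decay outweigh the number of prefixes.\<close>
  obtain c where c: "liminf (detection_quotient X) < ereal c" "c < 1 / 8"
    using ereal_dense2 [OF liminf] by auto
  have "frequently (\<lambda>k. detection_quotient X k < ereal c) sequentially"
  proof (rule ccontr)
    assume "\<not> ?thesis"
    then have "ereal c \<le> liminf (detection_quotient X)"
      by (intro Liminf_bounded) (simp add: not_frequently not_less)
    with c(1) show False by simp
  qed
  note freq = frequently_detection_quotient_less [OF ne disj this]
  define m where "m k = (INF y\<in>X. energy k y)" for k
  have m_le: "m k \<le> energy k y" if "y \<in> X" for k y
    unfolding m_def using that by (intro cINF_lower bdd_below_energy)
  have "\<exists>k. finite (Proj k X) \<and> real (card (Proj k X)) * exp (- (1 / 8) * m k) \<le> (1 / 2) ^ j" for j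
  proof -
    \<comment> \<open>Chosen so that \<open>(1 / 8 - c) * L = real j * ln 2\<close>, which gives the
      summable bound \<open>(1 / 2) ^ j\<close>.\<close>
    define L where "L = real j * ln 2 / (1 / 8 - c)"
    obtain k where k: "finite (Proj k X)" "ln (real (card (Proj k X))) \<le> c * m k" "L \<le> m k"
      using freq [of L] by (auto simp: m_def dest: frequently_ex)
    have "card (Proj k X) > 0"
      using k(1) ne by (auto simp: card_gt_0_iff Proj_def)
    then have "real (card (Proj k X)) \<le> exp (c * m k)"
      using k(2) by (metis exp_le_cancel_iff exp_ln of_nat_0_less_iff)
    then have "real (card (Proj k X)) * exp (- (1 / 8) * m k) \<le> exp (c * m k) * exp (- (1 / 8) * m k)"
      by (intro mult_right_mono) auto
    also have "\<dots> = exp (- ((1 / 8 - c) * m k))"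
      by (simp add: exp_add [symmetric] algebra_simps)
    also have "\<dots> \<le> exp (- (real j * ln 2))"
      using k(3) c(2) by (simp add: L_def field_simps)
    also have "\<dots> = (1 / 2) ^ j"
      by (simp add: exp_minus exp_of_nat_mult power_divide inverse_eq_divide)
    finally show ?thesis
      using k(1) by blast
  qed
  then obtain k where fin: "\<And>j. finite (Proj (k j) X)"
    and small: "\<And>j. real (card (Proj (k j) X)) * exp (- (1 / 8) * m (k j)) \<le> (1 / 2) ^ j"
    by metis
  define pass where
    "pass j y \<longleftrightarrow> (\<exists>v\<in>Proj (k j) X. energy (k j) (\<lambda>n. y n - v n) \<le> energy (k j) y)"
    for j and y :: "nat \<Rightarrow> 'a"
  define T :: "(nat \<Rightarrow> 'a) \<Rightarrow> nat" where
    "T y = (if eventually (\<lambda>j. pass j y) sequentially then 1 else 0)" for y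
  have [measurable]: "Measurable.pred borel (pass j)" for j
    unfolding pass_def
    using fin pred_energy_diff_le [where u = "\<lambda>_. 0"] by (intro pred_intros_finite(4)) simp_all
  have T': "T \<in> borel \<rightarrow>\<^sub>M count_space UNIV"
    unfolding T_def eventually_sequentially by measurable
  have T: "T \<in> borel \<rightarrow>\<^sub>M count_space {0, 1}"
    using measurable_sets [OF T', of "{0}"] measurable_sets [OF T', of "{1}"]
    by (auto simp: measurable_count_space_eq2 T_def)
  \<comment> \<open>Under noise alone the truth is 0, and a stage passes only if some prefix is
    confused with it. Writing \<open>v n - 0\<close> fits the union bound with the zero sequence as
    \<open>x\<close>.\<close>
  have "AE \<omega> in M. eventually (\<lambda>j. \<omega> \<notin> (\<Union>v\<in>Proj (k j) X. confusion (k j) (\<lambda>n. v n - 0))) sequentially"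
  proof (rule AE_eventually_not_in)
    show "prob (\<Union>v\<in>Proj (k j) X. confusion (k j) (\<lambda>n. v n - 0)) \<le> (1 / 2) ^ j" for j
      by (rule order_trans [OF prob_Union_confusion_Proj_le [OF fin, where b = "m (k j)"] small])
         (simp add: m_le)
  qed (use fin in auto)
  then have noise: "AE \<omega> in M. T (\<lambda>n. \<xi> n \<omega>) = 0"
  proof (rule AE_mp, intro AE_I2 impI)
    fix \<omega>
    assume "\<omega> \<in> space M" and "eventually (\<lambda>j. \<omega> \<notin> (\<Union>v\<in>Proj (k j) X. confusion (k j) (\<lambda>n. v n - 0))) sequentially"
    then have "eventually (\<lambda>j. \<not> pass j (\<lambda>n. \<xi> n \<omega>)) sequentially"
      by (elim eventually_mono) (auto simp: pass_def confusion_def)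
    then have "frequently (\<lambda>j. \<not> pass j (\<lambda>n. \<xi> n \<omega>)) sequentially"
      by (rule eventually_frequently [OF sequentially_bot])
    then show "T (\<lambda>n. \<xi> n \<omega>) = 0"
      by (simp add: T_def frequently_def)
  qed
  have signal: "AE \<omega> in M. T (\<lambda>n. x n + \<xi> n \<omega>) = 1" if x: "x \<in> X" for x
  proof -
    \<comment> \<open>The roles are now reversed: the truth is \<open>x\<close> and the only
      competitor is 0, at displacement \<open>- x\<close>.\<close>
    have "AE \<omega> in M. eventually (\<lambda>j. \<omega> \<notin> confusion (k j) (\<lambda>n. - x n)) sequentially"
    proof (rule AE_eventually_not_in)
      fix j
      \<comment> \<open>There is at least one prefix, so the majorant of the noise case also bounds
        this single error event.\<close>
      have "card (Proj (k j) X) > 0"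
        using fin [of j] ne by (auto simp: card_gt_0_iff Proj_def)
      then have "1 \<le> real (card (Proj (k j) X))"
        by simp
      have "prob (confusion (k j) (\<lambda>n. - x n)) \<le> 1 * exp (- (1 / 8) * m (k j))"
        using m_le [OF x, of "k j"] by (intro order_trans [OF prob_confusion_le]) simp
      also have "\<dots> \<le> real (card (Proj (k j) X)) * exp (- (1 / 8) * m (k j))"
        by (intro mult_right_mono) (fact, simp)
      finally show "prob (confusion (k j) (\<lambda>n. - x n)) \<le> (1 / 2) ^ j"
        using small [of j] by simp
    qed auto
    then show ?thesis
    proof (rule AE_mp, intro AE_I2 impI)
      fix \<omega>
      assume \<omega>: "\<omega> \<in> space M"
        and ev: "eventually (\<lambda>j. \<omega> \<notin> confusion (k j) (\<lambda>n. - x n)) sequentially"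
      \<comment> \<open>The prefix of \<open>x\<close> is the witness: subtracting it leaves the
        noise, which outside the confusion event has less energy than the observation.\<close>
      have "pass j (\<lambda>n. x n + \<xi> n \<omega>)" if "\<omega> \<notin> confusion (k j) (\<lambda>n. - x n)" for j
        unfolding pass_def
        using that x \<omega>
        by (intro bexI [of _ "restrict x {..<k j}"])
           (auto simp: Proj_def confusion_def not_le add.commute)
      with ev have "eventually (\<lambda>j. pass j (\<lambda>n. x n + \<xi> n \<omega>)) sequentially"
        by (rule eventually_mono)
      then show "T (\<lambda>n. x n + \<xi> n \<omega>) = 1"
        by (simp add: T_def)
    qed
  qed
  show ?thesis
    unfolding admits_detection_def using T noise signal by blast
qed

section \<open>Recovery by the nearest prefix\<close>

theorem recovery:
  fixes X :: "(nat \<Rightarrow> 'a) set"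
  assumes k: "filterlim k at_top sequentially"
    and sum: "\<And>x i. x \<in> X \<Longrightarrow> i \<ge> 1 \<Longrightarrow>
      (\<Sum>j. recovery_summand (prefix_differs X i x) x (k j)) < \<infinity>"
  shows "admits_recovery M \<xi> X"
proof (cases "\<exists>x. X \<subseteq> {x}")
  \<comment> \<open>With at most one candidate a constant map recovers it. Otherwise two distinct
    points provide a nonempty \<open>prefix_differs\<close> set, from which finiteness of the prefix
    sets is read off.\<close>
  case True
  then obtain x where "X \<subseteq> {x}" ..
  then show ?thesis
    unfolding admits_recovery_def by (intro exI [of _ "\<lambda>_. x"]) auto
next
  case False
  have summand: "recovery_summand (prefix_differs X i x) x (k j) < \<infinity>" if "x \<in> X" "i \<ge> 1" for x i j
    using sum [OF that] by (rule ennreal_suminf_lessD)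
  have fin: "finite (Proj (k j) X)" for j
  proof -
    obtain x where x: "x \<in> X"
      using False by auto
    then obtain y where y: "y \<in> X" "y \<noteq> x"
      using False by auto
    then obtain n where n: "y n \<noteq> x n"
      by blast
    \<comment> \<open>\<open>i > n\<close> puts \<open>y\<close> into the set, and
      \<open>i \<ge> k j\<close> forces every point of \<open>X\<close> outside it to share the
      prefix of \<open>x\<close> of length \<open>k j\<close>.\<close>
    define i where "i = max (k j) (Suc n)"
    have y_in: "y \<in> prefix_differs X i x"
      using y(1) n by (auto simp: prefix_differs_def i_def intro!: exI [of _ n])
    have "restrict z {..<k j} = restrict x {..<k j}" if "z \<in> X" "z \<notin> prefix_differs X i x" for z
      using that by (auto simp: prefix_differs_def i_def restrict_def fun_eq_iff)
    then have "Proj (k j) X \<subseteq> insert (restrict x {..<k j}) (Proj (k j) (prefix_differs X i x))"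
      by (auto simp: Proj_def)
    moreover have "finite (Proj (k j) (prefix_differs X i x))"
      by (rule finite_Proj_if_summand_finite [OF y_in summand [OF x]]) (simp add: i_def)
    ultimately show ?thesis
      by (simp add: finite_subset)
  qed
  have ne: "Proj (k j) X \<noteq> {}" for j
    using False by (auto simp: Proj_def)
  \<comment> \<open>Enumerating the finite prefix set by natural numbers, with repetitions, lets
    \<open>LEAST\<close> select a minimizer and break ties measurably.\<close>
  define w where "w j = from_nat_into (Proj (k j) X)" for j
  have w_in: "w j l \<in> Proj (k j) X" for j l
    unfolding w_def by (rule from_nat_into [OF ne])
  define nearest where "nearest j l y \<longleftrightarrow>
      (\<forall>v\<in>Proj (k j) X. energy (k j) (\<lambda>n. y n - w j l n) \<le> energy (k j) (\<lambda>n. y n - v n))"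
    for j l and y :: "nat \<Rightarrow> 'a"
  define est where "est j y = w j (LEAST l. nearest j l y)" for j y
  have nearest_est: "energy (k j) (\<lambda>n. y n - est j y n) \<le> energy (k j) (\<lambda>n. y n - v n)"
    if "v \<in> Proj (k j) X" for j y v
  proof -
    obtain u where u: "u \<in> Proj (k j) X"
        "\<forall>v\<in>Proj (k j) X. energy (k j) (\<lambda>n. y n - u n) \<le> energy (k j) (\<lambda>n. y n - v n)"
      using ex_is_arg_min_if_finite [OF fin [of j] ne [of j], where f = "\<lambda>u. energy (k j) (\<lambda>n. y n - u n)"]
      by (auto simp: is_arg_min_linorder)
    obtain l where "w j l = u"
      using from_nat_into_surj [OF countable_finite [OF fin] u(1)] by (auto simp: w_def)
    with u(2) have "nearest j l y"
      by (simp add: nearest_def)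
    then have "nearest j (LEAST l. nearest j l y) y"
      by (rule LeastI)
    with that show ?thesis
      by (auto simp: nearest_def est_def)
  qed
  \<comment> \<open>Coordinate \<open>n\<close> of \<open>est j y\<close> is
    \<open>undefined\<close> while \<open>k j \<le> n\<close>; this affects only finitely many
    \<open>j\<close> and hence not the limit.\<close>
  define T where "T y n = lim (\<lambda>j. est j y n)" for y n
  have [measurable]: "Measurable.pred borel (nearest j l)" for j l
    unfolding nearest_def using fin by (intro pred_intros_finite(3) pred_energy_diff_le)
  have [measurable]: "(\<lambda>y. est j y n) \<in> borel_measurable borel" for j n
  proof -
    have "(\<lambda>y. LEAST l. nearest j l y) \<in> borel \<rightarrow>\<^sub>M count_space UNIV"
      by measurable
    then show ?thesis
      unfolding est_def by (rule measurable_compose) simp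
  qed
  have "T \<in> borel_measurable borel"
    by (rule measurable_coordinatewise_then_product) (simp add: T_def)
  moreover have "AE \<omega> in M. T (\<lambda>n. x n + \<xi> n \<omega>) = x" if x: "x \<in> X" for x
  proof -
    have "AE \<omega> in M. T (\<lambda>n. x n + \<xi> n \<omega>) n = x n" for n
    proof -
      \<comment> \<open>\<open>Suc n\<close>, because \<open>prefix_differs\<close> compares only
        indices below its parameter and must include \<open>n\<close>.\<close>
      define Y where "Y = prefix_differs X (Suc n) x"
      have Y_sub: "Y \<subseteq> X"
        by (auto simp: Y_def prefix_differs_def)
      have finY: "finite (Proj (k j) Y)" for j
        using Y_sub by (intro finite_subset [OF _ fin]) (auto simp: Proj_def)
      define p where "p j = (if Y = {} then 0 else real (card (Proj (k j) Y)) *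
          exp (- (1 / 8) * (INF y\<in>Y. energy (k j) (\<lambda>n. y n - x n))))" for j
      have p_nonneg: "0 \<le> p j" for j
        by (simp add: p_def)
      have "recovery_summand Y x (k j) = ennreal (p j)" for j
        using finY by (simp add: recovery_summand_def p_def ennreal_mult ennreal_of_nat_eq_real_of_nat)
      then have "(\<Sum>j. ennreal (p j)) \<noteq> top"
        using sum [OF x, of "Suc n"] by (simp add: Y_def)
      then have "summable p"
        using p_nonneg by (rule summable_suminf_not_top [rotated])
      moreover have "prob (\<Union>v\<in>Proj (k j) Y. confusion (k j) (\<lambda>n. v n - x n)) \<le> p j" for j
      proof (cases "Y = {}")
        case False
        have lower: "(INF y\<in>Y. energy (k j) (\<lambda>n. y n - x n)) \<le> energy (k j) (\<lambda>n. y n - x n)"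
          if "y \<in> Y" for y
          by (rule cINF_lower [OF bdd_below_energy that])
        with False show ?thesis
          using prob_Union_confusion_Proj_le [OF finY lower] by (simp add: p_def)
      qed (simp add: p_def Proj_def)
      ultimately have
        "AE \<omega> in M. eventually (\<lambda>j. \<omega> \<notin> (\<Union>v\<in>Proj (k j) Y. confusion (k j) (\<lambda>n. v n - x n))) sequentially"
        using finY by (intro AE_eventually_not_in [where p = p]) auto
      then show ?thesis
      proof (rule AE_mp, intro AE_I2 impI)
        fix \<omega>
        let ?y = "\<lambda>n. x n + \<xi> n \<omega>"
        assume \<omega>: "\<omega> \<in> space M"
          and ev: "eventually (\<lambda>j. \<omega> \<notin> (\<Union>v\<in>Proj (k j) Y. confusion (k j) (\<lambda>n. v n - x n))) sequentially"
        have "eventually (\<lambda>j. Suc n \<le> k j) sequentially"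
          using k by (simp add: filterlim_at_top)
        with ev have "eventually (\<lambda>j. est j ?y n = x n) sequentially"
        proof eventually_elim
          case (elim j)
          obtain z where z: "z \<in> X" "est j ?y = restrict z {..<k j}"
            using w_in by (auto simp: est_def Proj_def)
          \<comment> \<open>The prefix of \<open>x\<close> is itself a candidate, so the chosen one
            is at least as close to the observation; a choice from \<open>Y\<close> would put
            \<open>\<omega>\<close> into an excluded confusion event.\<close>
          have "z \<notin> Y"
          proof
            assume "z \<in> Y"
            then have "est j ?y \<in> Proj (k j) Y"
              using z(2) by (auto simp: Proj_def)
            moreover have "\<omega> \<in> confusion (k j) (\<lambda>n. est j ?y n - x n)"
              using nearest_est [of "restrict x {..<k j}" j ?y] x \<omega>
              by (auto simp: confusion_def Proj_def algebra_simps)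
            ultimately show False
              using elim(1) by blast
          qed
          with z elim(2) show ?case
            by (auto simp: Y_def prefix_differs_def)
        qed
        then show "T ?y n = x n"
          unfolding T_def by (intro limI tendsto_eventually)
      qed
    qed
    then show ?thesis
      by (simp add: fun_eq_iff AE_all_countable)
  qed
  ultimately show ?thesis
    unfolding admits_recovery_def by blast
qed

end

section \<open>Real and complex noise as instances\<close>

theorem corollary5p8:
  fixes M :: "'w measure" and \<xi> :: "nat \<Rightarrow> 'w \<Rightarrow> real" and X :: "(nat \<Rightarrow> real) set"
    and N :: "'v measure" and \<zeta> :: "nat \<Rightarrow> 'v \<Rightarrow> complex" and Z :: "(nat \<Rightarrow> complex) set"
  shows
    "(real_gaussian_noise M \<xi> \<and> X \<in> sets borel \<longrightarrow>
       (X \<inter> ell2 = {} \<and> liminf (detection_quotient X) < ereal (1 / 8) \<longrightarrow>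
          admits_detection M \<xi> X) \<and>
       (\<forall>k :: nat \<Rightarrow> nat.
          mono k \<and> (\<forall>j. k j \<ge> 1) \<and> filterlim k at_top sequentially \<and>
          (\<forall>x\<in>X. \<forall>i\<ge>1.
             (\<Sum>j. recovery_summand (prefix_differs X i x) x (k j)) < \<infinity>) \<longrightarrow>
          admits_recovery M \<xi> X)) \<and>
     (complex_gaussian_noise N \<zeta> \<and> Z \<in> sets borel \<longrightarrow>
       (Z \<inter> ell2 = {} \<and> liminf (detection_quotient Z) < ereal (1 / 8) \<longrightarrow>
          admits_detection N \<zeta> Z) \<and>
       (\<forall>k :: nat \<Rightarrow> nat.
          mono k \<and> (\<forall>j. k j \<ge> 1) \<and> filterlim k at_top sequentially \<and>
          (\<forall>x\<in>Z. \<forall>i\<ge>1.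
             (\<Sum>j. recovery_summand (prefix_differs Z i x) x (k j)) < \<infinity>) \<longrightarrow>
          admits_recovery N \<zeta> Z))"
proof (intro conjI impI allI; (elim conjE)?)
  assume "real_gaussian_noise M \<xi>"
  then interpret gaussian_noise M \<xi>
    by (rule gaussian_noise_real)
  show "admits_detection M \<xi> X"
    if "X \<inter> ell2 = {}" "liminf (detection_quotient X) < ereal (1 / 8)"
    using that by (rule detection)
  show "admits_recovery M \<xi> X"
    if "filterlim k at_top sequentially"
      "\<forall>x\<in>X. \<forall>i\<ge>1. (\<Sum>j. recovery_summand (prefix_differs X i x) x (k j)) < \<infinity>" for k
    using that by (intro recovery [of k]) auto
next
  assume "complex_gaussian_noise N \<zeta>"
  then interpret gaussian_noise N \<zeta>
    by (rule gaussian_noise_complex)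
  show "admits_detection N \<zeta> Z"
    if "Z \<inter> ell2 = {}" "liminf (detection_quotient Z) < ereal (1 / 8)"
    using that by (rule detection)
  show "admits_recovery N \<zeta> Z"
    if "filterlim k at_top sequentially"
      "\<forall>x\<in>Z. \<forall>i\<ge>1. (\<Sum>j. recovery_summand (prefix_differs Z i x) x (k j)) < \<infinity>" for k
    using that by (intro recovery [of k]) auto
qed

end
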